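(* Let $(X,d)$ be a compact metric space and let $(Y_t)_{t\in \mathbb R}$ be a continuous flow on $X$ preserving two distinct Borel probability measures whose ergodic basins are both dense in $X$. Then the set $$\mathfrak I = \Big\{x \in X : \lim_{t \to +\infty} \frac1t \int_0^t \delta_{Y_s(x)} \, ds \text{ does not exist in the weak}^* \text{ topology}\Big\}$$ is a Baire residual subset of $X$.
   Context: For a $(Y_t)_{t\in\mathbb{R}}$-invariant Borel probability measure $\mu$, the ergodic basin of $\mu$ is the set of points $x \in X$ such that $\lim_{t \to +\infty} \frac1t\int_0^t \delta_{Y_s(x)}\,ds = \mu$ in the weak$^*$ topology. A subset of a topological space is Baire residual if it contains a countable intersection of open dense subsets. *)

theory Defs
  imports "HOL-Probability.Probability"
begin

definition continuous_flow :: "(real \<Rightarrow> 'a::topological_space \<Rightarrow> 'a) \<Rightarrow> bool" where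
  "continuous_flow Y \<longleftrightarrow>
     continuous_on UNIV (\<lambda>(t, x). Y t x) \<and>
     (\<forall>x. Y 0 x = x) \<and>
     (\<forall>s t x. Y (s + t) x = Y s (Y t x))"

abbreviation borel_prob_measures :: "'a::topological_space measure set" where
  "borel_prob_measures \<equiv> space (prob_algebra borel)"

definition flow_invariant :: "(real \<Rightarrow> 'a::topological_space \<Rightarrow> 'a) \<Rightarrow> 'a measure \<Rightarrow> bool" where
  "flow_invariant Y \<mu> \<longleftrightarrow> (\<forall>t. distr \<mu> borel (Y t) = \<mu>)"

text \<open>The initial topology for the maps taking a measure to its integral against a continuous
  function.  It is meant for compact spaces, where every continuous function is bounded.\<close>

definition weak_star_topology :: "'a::topological_space measure topology" where
  "weak_star_topology = topology_generated_by
     {{\<mu> \<in> borel_prob_measures. (\<integral>x. f x \<partial>\<mu>) \<in> U} | (f :: 'a \<Rightarrow> real) U.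
        continuous_on UNIV f \<and> open U}"

text \<open>The average of the Dirac measures at the points \<open>Y s x\<close>, where \<open>s\<close> has the normalised
  Lebesgue measure on \<open>[0, t]\<close>; only \<open>t > 0\<close> is meaningful.\<close>

definition time_average :: "(real \<Rightarrow> 'a::topological_space \<Rightarrow> 'a) \<Rightarrow> 'a \<Rightarrow> real \<Rightarrow> 'a measure" where
  "time_average Y x t = uniform_measure lborel {0..t} \<bind> (\<lambda>s. return borel (Y s x))"

definition ergodic_basin :: "(real \<Rightarrow> 'a::topological_space \<Rightarrow> 'a) \<Rightarrow> 'a measure \<Rightarrow> 'a set" where
  "ergodic_basin Y \<mu> = {x. limitin weak_star_topology (time_average Y x) \<mu> at_top}"

definition irregular_set :: "(real \<Rightarrow> 'a::topological_space \<Rightarrow> 'a) \<Rightarrow> 'a set" where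
  "irregular_set Y = {x. \<nexists>\<mu>. limitin weak_star_topology (time_average Y x) \<mu> at_top}"

definition baire_residual :: "'a::topological_space set \<Rightarrow> bool" where
  "baire_residual A \<longleftrightarrow>
     (\<exists>\<G>. countable \<G> \<and> (\<forall>G\<in>\<G>. open G \<and> closure G = UNIV) \<and> \<Inter>\<G> \<subseteq> A)"

lemma topspace_weak_star: "topspace weak_star_topology = borel_prob_measures"
proof -
  have "borel_prob_measures \<in> {{\<mu> \<in> borel_prob_measures. (\<integral>x. f x \<partial>\<mu>) \<in> U} | (f :: 'a \<Rightarrow> real) U.
        continuous_on UNIV f \<and> open U}"
    by (rule CollectI, rule exI[of _ "\<lambda>_. 0"], rule exI[of _ UNIV]) auto
  then show ?thesis
    unfolding weak_star_topology_def topology_generated_by_topspace by blast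
qed

lemma limitin_weak_star_iff:
  fixes M :: "'b \<Rightarrow> 'a::topological_space measure"
  assumes M: "eventually (\<lambda>t. M t \<in> borel_prob_measures) F"
  shows "limitin weak_star_topology M \<mu> F \<longleftrightarrow>
    \<mu> \<in> borel_prob_measures \<and>
    (\<forall>f :: 'a \<Rightarrow> real. continuous_on UNIV f \<longrightarrow> ((\<lambda>t. \<integral>x. f x \<partial>M t) \<longlongrightarrow> (\<integral>x. f x \<partial>\<mu>)) F)"
    (is "?L \<longleftrightarrow> ?R")
proof
  assume L: ?L
  have "((\<lambda>t. \<integral>x. f x \<partial>M t) \<longlongrightarrow> (\<integral>x. f x \<partial>\<mu>)) F" if f: "continuous_on UNIV f"
    for f :: "'a \<Rightarrow> real"
  proof (rule topological_tendstoI)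
    fix U :: "real set" assume U: "open U" "(\<integral>x. f x \<partial>\<mu>) \<in> U"
    have "openin weak_star_topology {\<mu> \<in> borel_prob_measures. (\<integral>x. f x \<partial>\<mu>) \<in> U}"
      unfolding weak_star_topology_def
      by (rule topology_generated_by_Basis) (use f U in blast)
    then have "eventually (\<lambda>t. M t \<in> {\<mu> \<in> borel_prob_measures. (\<integral>x. f x \<partial>\<mu>) \<in> U}) F"
      using L U unfolding limitin_def topspace_weak_star by blast
    then show "eventually (\<lambda>t. (\<integral>x. f x \<partial>M t) \<in> U) F"
      by (rule eventually_mono) auto
  qed
  then show ?R using L by (auto simp: limitin_def topspace_weak_star)
next
  assume R: ?R
  have "eventually (\<lambda>t. M t \<in> V) F" if "openin weak_star_topology V" "\<mu> \<in> V" for V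
  proof -
    have "generate_topology_on {{\<mu> \<in> borel_prob_measures. (\<integral>x. f x \<partial>\<mu>) \<in> U} |
        (f :: 'a \<Rightarrow> real) U. continuous_on UNIV f \<and> open U} V"
      using that(1) unfolding weak_star_topology_def openin_topology_generated_by_iff .
    then show ?thesis using \<open>\<mu> \<in> V\<close>
    proof (induction rule: generate_topology_on.induct)
      case Empty then show ?case by simp
    next
      case (Int a b) then show ?case by (simp add: eventually_conj)
    next
      case (UN K)
      then obtain k where k: "k \<in> K" "\<mu> \<in> k" by blast
      then have "eventually (\<lambda>t. M t \<in> k) F" using UN by blast
      then show ?case by (rule eventually_mono) (use k in blast)
    next
      case (Basis s)
      then obtain f :: "'a \<Rightarrow> real" and U where fU: "continuous_on UNIV f" "open U"
        and s: "s = {\<mu> \<in> borel_prob_measures. (\<integral>x. f x \<partial>\<mu>) \<in> U}" by blast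
      have "eventually (\<lambda>t. (\<integral>x. f x \<partial>M t) \<in> U) F"
        using R fU Basis(2) s topological_tendstoD by fastforce
      then show ?case using M unfolding s by eventually_elim auto
    qed
  qed
  then show ?L using R by (auto simp: limitin_def topspace_weak_star)
qed

lemma continuous_flow_orbit: "continuous_flow Y \<Longrightarrow> continuous_on UNIV (\<lambda>s. Y s x)"
proof -
  assume "continuous_flow Y"
  then have "continuous_on UNIV (\<lambda>(t, x). Y t x)" by (simp add: continuous_flow_def)
  then have "continuous_on UNIV (\<lambda>s. (\<lambda>(t, x). Y t x) (s, x))"
    by (rule continuous_on_compose2) (auto intro!: continuous_intros)
  then show ?thesis by simp
qed

lemma orbit_measurable:
  assumes "continuous_flow Y"
  shows "(\<lambda>s. Y s x) \<in> borel_measurable borel"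
  by (intro borel_measurable_continuous_onI continuous_flow_orbit assms)

lemma time_average_eq_distr:
  assumes "continuous_flow Y"
  shows "time_average Y x t = distr (uniform_measure lborel {0..t}) borel (\<lambda>s. Y s x)"
  unfolding time_average_def
  by (rule bind_return_distr')
    (use orbit_measurable[OF assms] in \<open>auto simp: measurable_def\<close>)

lemma time_average_prob:
  assumes "continuous_flow Y" "t > 0"
  shows "time_average Y x t \<in> borel_prob_measures"
proof -
  interpret prob_space "uniform_measure lborel {0..t}"
    by (rule prob_space_uniform_measure) (use assms in auto)
  show ?thesis
    unfolding time_average_eq_distr[OF assms(1)] space_prob_algebra
    using orbit_measurable[OF assms(1), of x]
    by (auto intro!: prob_space_distr simp: measurable_def)
qed

lemma integral_time_average:
  fixes f :: "'a::topological_space \<Rightarrow> real"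
  assumes Y: "continuous_flow Y" and t: "t > 0" and f: "continuous_on UNIV f"
  shows "(\<integral>y. f y \<partial>time_average Y x t) = (1 / t) * (LBINT s=0..t. f (Y s x))"
proof -
  have m: "(\<lambda>s. Y s x) \<in> borel_measurable borel" "f \<in> borel_measurable borel"
    by (auto intro!: borel_measurable_continuous_onI continuous_flow_orbit Y f)
  have fm: "(\<lambda>s. f (Y s x)) \<in> borel_measurable borel"
    using measurable_compose[OF m] .
  have u: "uniform_measure lborel {0..t} = density lborel (\<lambda>s. ennreal (indicator {0..t} s / t))"
    unfolding uniform_measure_def
    using t by (intro density_cong)
      (auto simp: indicator_def divide_ennreal simp flip: ennreal_1 split: if_splits)
  have "(\<integral>y. f y \<partial>time_average Y x t) = (\<integral>s. f (Y s x) \<partial>uniform_measure lborel {0..t})"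
    unfolding time_average_eq_distr[OF Y] by (rule integral_distr) (use m in auto)
  also have "\<dots> = (\<integral>s. (indicator {0..t} s / t) *\<^sub>R f (Y s x) \<partial>lborel)"
    unfolding u by (rule integral_density) (use fm t in auto)
  also have "\<dots> = (1 / t) * (\<integral>s. indicator {0..t} s *\<^sub>R f (Y s x) \<partial>lborel)"
    by (subst integral_mult_right_zero[symmetric]) (simp add: field_simps)
  also have "(\<integral>s. indicator {0..t} s *\<^sub>R f (Y s x) \<partial>lborel) = (LBINT s=0..t. f (Y s x))"
    using t interval_integral_Icc[of 0 t "\<lambda>s. f (Y s x)"]
    by (simp add: set_lebesgue_integral_def zero_ereal_def)
  finally show ?thesis .
qed

end

theory Submission
  imports Defs
begin

text \<open>The argument tests convergence against a single observable. Distinct Borel probability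
  measures \<open>\<mu>\<close> and \<open>\<nu>\<close> on a metric space are told apart by a bounded continuous \<open>f\<close>
  (lemma \<open>separating_continuous_function\<close>); say \<open>\<integral>f d\<mu> < a < b < \<integral>f d\<nu>\<close>.
  The Birkhoff average of \<open>f\<close> over \<open>[0, t]\<close> depends continuously on the starting point, so
  for each \<open>n\<close> it is an open condition that the average drops below \<open>a\<close> at some time after \<open>n\<close>.
  Every point in the basin of \<open>\<mu>\<close> satisfies it, so the condition is also dense. The same
  holds for exceeding \<open>b\<close>, with the basin of \<open>\<nu>\<close> (lemma \<open>dense_open_late_visits\<close>). A point
  that satisfies these countably many conditions has Birkhoff averages of \<open>f\<close> that oscillate
  across \<open>[a, b]\<close> forever, so its time averages have no weak-star limit.\<close>

text \<open>Closed sets form an intersection-stable generator of the Borel sets, and the indicator of a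
  nonempty closed set is the pointwise limit of continuous functions with values in \<open>[0, 1]\<close>.
  So, by dominated convergence, the integrals of such functions determine the measure.\<close>

lemma separating_continuous_function:
  fixes \<mu> \<nu> :: "'a::metric_space measure"
  assumes \<mu>: "\<mu> \<in> borel_prob_measures" and \<nu>: "\<nu> \<in> borel_prob_measures" and "\<mu> \<noteq> \<nu>"
  obtains f :: "'a \<Rightarrow> real" where "continuous_on UNIV f" "\<And>x. \<bar>f x\<bar> \<le> 1"
    "(\<integral>x. f x \<partial>\<mu>) \<noteq> (\<integral>x. f x \<partial>\<nu>)"
proof (rule ccontr)
  note separated = that
  assume no_f: "\<not> thesis"
  have eq: "(\<integral>x. f x \<partial>\<mu>) = (\<integral>x. f x \<partial>\<nu>)"
    if "continuous_on UNIV f" "\<And>x. \<bar>f x\<bar> \<le> 1" for f :: "'a \<Rightarrow> real"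
    using no_f separated that by blast
  have closed_eq: "emeasure \<mu> C = emeasure \<nu> C" if C: "closed C" for C
  proof (cases "C = {}")
    case False
    define g where "g n x = max 0 (1 - real n * infdist x C)" for n :: nat and x
    have cont: "continuous_on UNIV (g n)" for n
      unfolding g_def by (intro continuous_intros)
    have bound: "\<bar>g n x\<bar> \<le> 1" for n x
      using infdist_nonneg[of x C] by (auto simp: g_def max_def)
    have lim: "(\<lambda>n. g n x) \<longlonglongrightarrow> indicator C x" for x
    proof (cases "x \<in> C")
      case True
      then show ?thesis by (simp add: g_def)
    next
      case False
      then have pos: "infdist x C > 0"
        using C \<open>C \<noteq> {}\<close> in_closed_iff_infdist_zero[of C x] infdist_nonneg[of x C] by auto
      then obtain N :: nat where N: "1 < real N * infdist x C"
        using ex_less_of_nat_mult by blast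
      have "g n x = 0" if "n \<ge> N" for n
      proof -
        have "real N * infdist x C \<le> real n * infdist x C"
          using that pos by (intro mult_right_mono) auto
        then show ?thesis using N by (simp add: g_def)
      qed
      then show ?thesis
        using False by (auto intro!: tendsto_eventually eventually_sequentiallyI)
    qed
    have int: "(\<lambda>n. \<integral>x. g n x \<partial>\<rho>) \<longlonglongrightarrow> measure \<rho> C" if \<rho>: "\<rho> \<in> borel_prob_measures" for \<rho>
    proof -
      interpret prob_space \<rho> using \<rho> by (simp add: space_prob_algebra)
      have [measurable_cong]: "sets \<rho> = sets borel" using \<rho> by (simp add: space_prob_algebra)
      have [measurable]: "g n \<in> borel_measurable borel" for n
        using cont by (rule borel_measurable_continuous_onI)
      have [measurable]: "C \<in> sets borel" using C by simp
      have "(\<lambda>n. \<integral>x. g n x \<partial>\<rho>) \<longlonglongrightarrow> (\<integral>x. indicator C x \<partial>\<rho>)"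
        by (rule integral_dominated_convergence[where w = "\<lambda>_. 1"])
          (use lim bound in auto)
      then show ?thesis using sets_eq_imp_space_eq[OF \<open>sets \<rho> = sets borel\<close>] by simp
    qed
    have "measure \<mu> C = measure \<nu> C"
      using int[OF \<mu>] int[OF \<nu>] eq[OF cont bound] LIMSEQ_unique by simp
    moreover have "finite_measure \<mu>" "finite_measure \<nu>"
      using \<mu> \<nu> by (auto simp: space_prob_algebra prob_space_def)
    ultimately show ?thesis by (simp add: finite_measure.emeasure_eq_measure)
  qed simp
  have "\<mu> = \<nu>"
  proof (rule measure_eqI_generator_eq[where E = "Collect closed" and A = "\<lambda>_. UNIV"])
    show "sets \<mu> = sigma_sets UNIV (Collect closed)" "sets \<nu> = sigma_sets UNIV (Collect closed)"
      using \<mu> \<nu> by (simp_all add: space_prob_algebra borel_eq_closed)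
    show "emeasure \<mu> UNIV \<noteq> \<infinity>" for i :: nat
      using \<mu> by (simp add: space_prob_algebra prob_space_def finite_measure.emeasure_eq_measure)
  qed (use closed_eq in \<open>auto simp: Int_stable_def\<close>)
  with \<open>\<mu> \<noteq> \<nu>\<close> show False by simp
qed

text \<open>The orbit segment over \<open>[0, t]\<close> varies pointwise in time with its starting point, and the
  bound on \<open>f\<close> lets dominated convergence carry this over to the integral.\<close>

lemma continuous_on_integral_time_average:
  fixes Y :: "real \<Rightarrow> 'a::metric_space \<Rightarrow> 'a" and f :: "'a \<Rightarrow> real"
  assumes Y: "continuous_flow Y" and t: "t > 0"
    and f: "continuous_on UNIV f" and bound: "\<And>x. \<bar>f x\<bar> \<le> B"
  shows "continuous_on UNIV (\<lambda>x. \<integral>y. f y \<partial>time_average Y x t)"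
proof -
  interpret prob_space "uniform_measure lborel {0..t}"
    by (rule prob_space_uniform_measure) (use t in auto)
  have [measurable]: "f \<in> borel_measurable borel"
    using f by (rule borel_measurable_continuous_onI)
  have [measurable]: "(\<lambda>s. Y s x) \<in> borel_measurable borel" for x
    by (rule orbit_measurable[OF Y])
  have avg: "(\<integral>y. f y \<partial>time_average Y x t) = (\<integral>s. f (Y s x) \<partial>uniform_measure lborel {0..t})"
    for x
    unfolding time_average_eq_distr[OF Y] by (rule integral_distr) auto
  have Ys: "continuous_on UNIV (Y s)" for s
  proof -
    have "continuous_on UNIV (\<lambda>(t, x). Y t x)"
      using Y by (simp add: continuous_flow_def)
    then have "continuous_on UNIV (\<lambda>x. (\<lambda>(t, x). Y t x) (s, x))"
      by (rule continuous_on_compose2) (auto intro!: continuous_intros)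
    then show ?thesis by simp
  qed
  show ?thesis
    unfolding continuous_on_sequentially comp_def avg
  proof (intro ballI allI impI, elim conjE)
    fix x and u :: "nat \<Rightarrow> 'a" assume u: "u \<longlonglongrightarrow> x"
    have "continuous_on UNIV (\<lambda>x. f (Y s x))" for s
      by (rule continuous_on_compose2[OF f Ys]) simp
    then have "(\<lambda>n. f (Y s (u n))) \<longlonglongrightarrow> f (Y s x)" for s
      using u by (rule continuous_on_tendsto_compose) auto
    then show "(\<lambda>n. \<integral>s. f (Y s (u n)) \<partial>uniform_measure lborel {0..t})
        \<longlonglongrightarrow> (\<integral>s. f (Y s x) \<partial>uniform_measure lborel {0..t})"
      by (intro integral_dominated_convergence[where w = "\<lambda>_. B"]) (use bound in auto)
  qed
qed

lemma limitin_time_average_integral: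
  fixes f :: "'a::topological_space \<Rightarrow> real"
  assumes Y: "continuous_flow Y" and f: "continuous_on UNIV f"
    and lim: "limitin weak_star_topology (time_average Y x) \<rho> at_top"
  shows "((\<lambda>t. \<integral>y. f y \<partial>time_average Y x t) \<longlongrightarrow> (\<integral>y. f y \<partial>\<rho>)) at_top"
proof -
  have "eventually (\<lambda>t. time_average Y x t \<in> borel_prob_measures) at_top"
    using eventually_gt_at_top[of 0] by eventually_elim (rule time_average_prob[OF Y])
  from limitin_weak_star_iff[OF this] lim f show ?thesis by blast
qed

text \<open>The set is open as a union of preimages of \<open>U\<close> under continuous functions, and dense
  because along the orbit of a point in the basin the averages of \<open>f\<close> are eventually in \<open>U\<close>.\<close>

lemma dense_open_late_visits:
  fixes Y :: "real \<Rightarrow> 'a::metric_space \<Rightarrow> 'a" and f :: "'a \<Rightarrow> real"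
  assumes Y: "continuous_flow Y"
    and f: "continuous_on UNIV f" and bound: "\<And>x. \<bar>f x\<bar> \<le> B"
    and basin: "closure (ergodic_basin Y \<rho>) = UNIV"
    and U: "open U" "(\<integral>y. f y \<partial>\<rho>) \<in> U" and T: "T \<ge> 0"
  defines "V \<equiv> {x. \<exists>t>T. (\<integral>y. f y \<partial>time_average Y x t) \<in> U}"
  shows "open V" "closure V = UNIV"
proof -
  have "open ((\<lambda>x. \<integral>y. f y \<partial>time_average Y x t) -` U)" if "t > T" for t
    using that T by (intro open_vimage U continuous_on_integral_time_average[OF Y _ f bound]) auto
  moreover have "V = (\<Union>t\<in>{T<..}. (\<lambda>x. \<integral>y. f y \<partial>time_average Y x t) -` U)"
    by (auto simp: V_def)
  ultimately show "open V" by auto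
  have "ergodic_basin Y \<rho> \<subseteq> V"
  proof
    fix x assume "x \<in> ergodic_basin Y \<rho>"
    then have "((\<lambda>t. \<integral>y. f y \<partial>time_average Y x t) \<longlongrightarrow> (\<integral>y. f y \<partial>\<rho>)) at_top"
      unfolding ergodic_basin_def using limitin_time_average_integral[OF Y f] by blast
    then have "eventually (\<lambda>t. (\<integral>y. f y \<partial>time_average Y x t) \<in> U) at_top"
      using U by (rule topological_tendstoD)
    then have "eventually (\<lambda>t. t > T \<and> (\<integral>y. f y \<partial>time_average Y x t) \<in> U) at_top"
      using eventually_gt_at_top[of T] by eventually_elim simp
    then show "x \<in> V"
      unfolding V_def using eventually_happens' trivial_limit_at_top_linorder by blast
  qed
  then show "closure V = UNIV" using basin closure_mono by blast
qed

text \<open>The two thresholds \<open>a < b\<close> exclude every candidate limit: a limit below \<open>b\<close> contradicts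
  the late visits above \<open>b\<close>, and any other limit exceeds \<open>a\<close>, which contradicts the late visits
  below \<open>a\<close>.\<close>

lemma residual_irregular_set:
  fixes Y :: "real \<Rightarrow> 'a::metric_space \<Rightarrow> 'a" and f :: "'a \<Rightarrow> real"
  assumes Y: "continuous_flow Y"
    and f: "continuous_on UNIV f" and bound: "\<And>x. \<bar>f x\<bar> \<le> B"
    and basins: "closure (ergodic_basin Y \<mu>) = UNIV" "closure (ergodic_basin Y \<nu>) = UNIV"
    and less: "(\<integral>y. f y \<partial>\<mu>) < (\<integral>y. f y \<partial>\<nu>)"
  shows "baire_residual (irregular_set Y)"
proof -
  define A where "A x t = (\<integral>y. f y \<partial>time_average Y x t)" for x t
  obtain a where a: "(\<integral>y. f y \<partial>\<mu>) < a" "a < (\<integral>y. f y \<partial>\<nu>)"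
    using dense[OF less] by blast
  obtain b where b: "a < b" "b < (\<integral>y. f y \<partial>\<nu>)"
    using dense[OF a(2)] by blast
  define L where "L n = {x. \<exists>t>real n. A x t \<in> {..<a}}" for n :: nat
  define H where "H n = {x. \<exists>t>real n. A x t \<in> {b<..}}" for n :: nat
  have L: "open (L n)" "closure (L n) = UNIV" for n
    unfolding L_def A_def
    using dense_open_late_visits[OF Y f bound basins(1), of "{..<a}" "real n"] a by auto
  have H: "open (H n)" "closure (H n) = UNIV" for n
    unfolding H_def A_def
    using dense_open_late_visits[OF Y f bound basins(2), of "{b<..}" "real n"] b by auto
  have "x \<in> irregular_set Y" if x: "\<And>n. x \<in> L n" "\<And>n. x \<in> H n" for x
  proof (rule ccontr)
    assume "x \<notin> irregular_set Y"
    then obtain \<rho> where "limitin weak_star_topology (time_average Y x) \<rho> at_top"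
      by (auto simp: irregular_set_def)
    then have lim: "(A x \<longlongrightarrow> (\<integral>y. f y \<partial>\<rho>)) at_top"
      unfolding A_def by (rule limitin_time_average_integral[OF Y f])
    show False
    proof (cases "(\<integral>y. f y \<partial>\<rho>) < b")
      case True
      then obtain T where T: "\<And>t. t \<ge> T \<Longrightarrow> A x t < b"
        using order_tendstoD(2)[OF lim] by (auto simp: eventually_at_top_linorder)
      obtain n where "T < real n" using reals_Archimedean2 by blast
      moreover obtain t where "t > real n" "A x t > b"
        using x(2)[of n] by (auto simp: H_def)
      ultimately show False using T[of t] by simp
    next
      case False
      then have "a < (\<integral>y. f y \<partial>\<rho>)" using b by simp
      then obtain T where T: "\<And>t. t \<ge> T \<Longrightarrow> a < A x t"
        using order_tendstoD(1)[OF lim] by (auto simp: eventually_at_top_linorder)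
      obtain n where "T < real n" using reals_Archimedean2 by blast
      moreover obtain t where "t > real n" "A x t < a"
        using x(1)[of n] by (auto simp: L_def)
      ultimately show False using T[of t] by simp
    qed
  qed
  then show ?thesis
    unfolding baire_residual_def
    by (intro exI[of _ "range L \<union> range H"]) (use L H in auto)
qed

theorem corollary8:
  fixes Y :: "real \<Rightarrow> 'a::metric_space \<Rightarrow> 'a"
    and \<mu> \<nu> :: "'a measure"
  assumes "compact (UNIV :: 'a set)"
    and "continuous_flow Y"
    and "\<mu> \<in> borel_prob_measures" and "flow_invariant Y \<mu>"
    and "\<nu> \<in> borel_prob_measures" and "flow_invariant Y \<nu>"
    and "\<mu> \<noteq> \<nu>"
    and "closure (ergodic_basin Y \<mu>) = UNIV"
    and "closure (ergodic_basin Y \<nu>) = UNIV"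
  shows "baire_residual (irregular_set Y)"
proof -
  obtain f :: "'a \<Rightarrow> real" where f: "continuous_on UNIV f" "\<And>x. \<bar>f x\<bar> \<le> 1"
    and neq: "(\<integral>x. f x \<partial>\<mu>) \<noteq> (\<integral>x. f x \<partial>\<nu>)"
    using separating_continuous_function[OF assms(3,5,7)] by blast
  \<comment> \<open>The two measures enter symmetrically, so either order of the integrals will do.\<close>
  from neq consider "(\<integral>x. f x \<partial>\<mu>) < (\<integral>x. f x \<partial>\<nu>)" | "(\<integral>x. f x \<partial>\<nu>) < (\<integral>x. f x \<partial>\<mu>)"
    by linarith
  then show ?thesis
  proof cases
    case 1
    then show ?thesis by (rule residual_irregular_set[OF assms(2) f assms(8,9)])
  next
    case 2
    then show ?thesis by (rule residual_irregular_set[OF assms(2) f assms(9,8)])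
  qed
qed

end
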